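(* Every infinite-dimensional closed ${}^*$-subalgebra of $s$ is isomorphic as a Fr\'echet ${}^*$-algebra to $\lambda^\infty(n_k^q)$ for some strictly increasing sequence $(n_k)_{k\in\mathbb{N}}$ of natural numbers. Conversely, if $(n_k)_{k\in\mathbb{N}}$ is a strictly increasing sequence of natural numbers, then $\lambda^\infty(n_k^q)$ is isomorphic as a Fr\'echet ${}^*$-algebra to some infinite-dimensional closed ${}^*$-subalgebra of $s$. Moreover, every closed ${}^*$-subalgebra of $s$ is a complemented subspace of $s$.
   Context: $\mathbb{N}=\{1,2,\dots\}$ (natural numbers), $\mathbb{N}_0=\mathbb{N}\cup\{0\}$; all spaces are over $\mathbb{C}$. A Fr\'echet ${}^*$-algebra is a Fr\'echet space (complete metrizable locally convex space) that is an algebra with continuous multiplication and continuous involution; an isomorphism of Fr\'echet ${}^*$-algebras is an algebra ${}^*$-isomorphism that is also a homeomorphism. $s=\{\xi=(\xi_j)_{j\in\mathbb{N}}\in\mathbb{C}^{\mathbb{N}}:|\xi|_q:=(\sum_{j=1}^\infty|\xi_j|^2j^{2q})^{1/2}<\infty\text{ for all }q\in\mathbb{N}_0\}$ with the topology of the norms $(|\cdot|_q)_{q\in\mathbb{N}_0}$; it is a Fr\'echet ${}^*$-algebra with pointwise multiplication and pointwise complex conjugation. For a sequence $(n_k)_{k\in\mathbb{N}}\subset\mathbb{N}$, $\lambda^\infty(n_k^q):=\{\xi=(\xi_k)_{k\in\mathbb{N}}\in\mathbb{C}^{\mathbb{N}}:\sup_{k\in\mathbb{N}}|\xi_k|n_k^q<\infty\text{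 for all }q\in\mathbb{N}_0\}$ with the topology given by the norms $\sup_k|\xi_k|n_k^q$, $q\in\mathbb{N}_0$, and with pointwise multiplication and complex conjugation. A subspace $F$ of a Fr\'echet space $X$ is complemented if there is a continuous linear projection $\pi:X\to X$ with image $F$. *)

theory Defs
  imports "HOL-Analysis.Analysis" "HOL-Library.Function_Algebras"
begin

text \<open>
  Complex sequences are functions \<open>nat \<Rightarrow> complex\<close> with the pointwise ring operations of
  \<open>Function_Algebras\<close>.  Since the sequences of the paper are indexed by \<open>1, 2, 3, \<dots>\<close>, the value
  at \<open>i :: nat\<close> is the entry with index \<open>i + 1\<close>.
\<close>

type_synonym cseq = "nat \<Rightarrow> complex"

definition cscale :: "complex \<Rightarrow> cseq \<Rightarrow> cseq" where
  "cscale c \<xi> = (\<lambda>i. c * \<xi> i)"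

definition star :: "cseq \<Rightarrow> cseq" where
  "star \<xi> = (\<lambda>i. cnj (\<xi> i))"

interpretation cseq: vector_space cscale
  by unfold_locales (auto simp: cscale_def fun_eq_iff algebra_simps)

definition infinite_dimensional :: "cseq set \<Rightarrow> bool" where
  "infinite_dimensional V \<longleftrightarrow> (\<nexists>B. finite B \<and> B \<subseteq> V \<and> cseq.span B = V)"


text \<open>
  The locally convex topology on \<open>X\<close> given by a sequence of seminorms: all open balls, with
  arbitrary centre in \<open>X\<close>, form a subbase.
\<close>

definition seminorm_topology :: "cseq set \<Rightarrow> (nat \<Rightarrow> cseq \<Rightarrow> real) \<Rightarrow> cseq topology" where
  "seminorm_topology X p =
     topology_generated_by {{\<eta> \<in> X. p q (\<eta> - \<xi>) < e} | q \<xi> e. \<xi> \<in> X \<and> e > 0}"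

lemma topspace_seminorm_topology:
  assumes "\<And>q. p q 0 = 0"
  shows "topspace (seminorm_topology X p) = X"
proof
  show "topspace (seminorm_topology X p) \<subseteq> X"
    unfolding seminorm_topology_def topology_generated_by_topspace by blast
  show "X \<subseteq> topspace (seminorm_topology X p)"
  proof
    fix \<xi> assume "\<xi> \<in> X"
    then have "\<xi> \<in> {\<eta> \<in> X. p 0 (\<eta> - \<xi>) < 1}"
      using assms by simp
    moreover have "{\<eta> \<in> X. p 0 (\<eta> - \<xi>) < 1} \<in> {{\<eta> \<in> X. p q (\<eta> - \<xi>) < e} | q \<xi> e. \<xi> \<in> X \<and> e > 0}"
      using \<open>\<xi> \<in> X\<close> zero_less_one by blast
    ultimately show "\<xi> \<in> topspace (seminorm_topology X p)"
      unfolding seminorm_topology_def topology_generated_by_topspace by blast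
  qed
qed


definition s_norm :: "nat \<Rightarrow> cseq \<Rightarrow> real" where
  "s_norm q \<xi> = sqrt (\<Sum>i. (cmod (\<xi> i))\<^sup>2 * real (Suc i) ^ (2 * q))"

definition s_space :: "cseq set" where
  "s_space = {\<xi>. \<forall>q. summable (\<lambda>i. (cmod (\<xi> i))\<^sup>2 * real (Suc i) ^ (2 * q))}"

definition s_topology :: "cseq topology" where
  "s_topology = seminorm_topology s_space s_norm"

lemma topspace_s_topology [simp]: "topspace s_topology = s_space"
  unfolding s_topology_def
  by (rule topspace_seminorm_topology) (simp add: s_norm_def)

definition lambda_norm :: "(nat \<Rightarrow> nat) \<Rightarrow> nat \<Rightarrow> cseq \<Rightarrow> real" where
  "lambda_norm n q \<xi> = (SUP k. cmod (\<xi> k) * real (n k) ^ q)"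

definition lambda_space :: "(nat \<Rightarrow> nat) \<Rightarrow> cseq set" where
  "lambda_space n = {\<xi>. \<forall>q. bdd_above (range (\<lambda>k. cmod (\<xi> k) * real (n k) ^ q))}"

definition lambda_topology :: "(nat \<Rightarrow> nat) \<Rightarrow> cseq topology" where
  "lambda_topology n = seminorm_topology (lambda_space n) (lambda_norm n)"

lemma topspace_lambda_topology [simp]: "topspace (lambda_topology n) = lambda_space n"
  unfolding lambda_topology_def
  by (rule topspace_seminorm_topology) (simp add: lambda_norm_def)


text \<open>
  A Fr\'echet \<open>*\<close>-algebra of sequences is represented by its topology; its underlying set is the
  \<open>topspace\<close>, and the algebraic operations are the pointwise ones.  Algebras need not be unital.
\<close>

definition linear_map_on :: "cseq set \<Rightarrow> (cseq \<Rightarrow> cseq) \<Rightarrow> bool" where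
  "linear_map_on V f \<longleftrightarrow>
     (\<forall>x\<in>V. \<forall>y\<in>V. f (x + y) = f x + f y) \<and> (\<forall>c. \<forall>x\<in>V. f (cscale c x) = cscale c (f x))"

definition closed_star_subalgebra :: "cseq topology \<Rightarrow> cseq set \<Rightarrow> bool" where
  "closed_star_subalgebra T A \<longleftrightarrow>
     closedin T A \<and> cseq.subspace A \<and> (\<forall>x\<in>A. \<forall>y\<in>A. x * y \<in> A) \<and> (\<forall>x\<in>A. star x \<in> A)"

definition frechet_star_isomorphic :: "cseq topology \<Rightarrow> cseq topology \<Rightarrow> bool" where
  "frechet_star_isomorphic S T \<longleftrightarrow>
     (\<exists>\<phi>. homeomorphic_map S T \<phi> \<and> linear_map_on (topspace S) \<phi> \<and>
          (\<forall>x\<in>topspace S. \<forall>y\<in>topspace S. \<phi> (x * y) = \<phi> x * \<phi> y) \<and>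
          (\<forall>x\<in>topspace S. \<phi> (star x) = star (\<phi> x)))"

definition complemented_subspace :: "cseq topology \<Rightarrow> cseq set \<Rightarrow> bool" where
  "complemented_subspace T F \<longleftrightarrow>
     (\<exists>\<pi>. continuous_map T T \<pi> \<and> linear_map_on (topspace T) \<pi> \<and>
          (\<forall>x\<in>topspace T. \<pi> (\<pi> x) = \<pi> x) \<and> \<pi> ` topspace T = F)"

end

theory Submission
  imports Defs
begin

text \<open>
  The Hilbertian norms of \<open>s\<close> and the weighted supremum norms
  \<open>sup |\<xi>\<^sub>j| j^q\<close> define the same space and the same topology: each Hilbertian norm dominates
  the supremum norm of the same order, and is dominated, up to a constant, by the one of the next order because
  \<open>\<Sum> 1/j\<^sup>2\<close> converges (\<open>s_topology_eq\<close>).  So \<open>s\<close> is itself the space \<open>\<lambda>\<^sup>\<infinity>(j^q)\<close>, and everything can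
  be done with supremum norms.

  A closed star-subalgebra \<open>A\<close> of \<open>s\<close> partitions the indices: two indices belong together when no
  element of \<open>A\<close> separates them.  One block may consist of common zeros of \<open>A\<close>; each
  other block is finite because the elements of \<open>A\<close> tend to zero.  The indicator of such a
  block lies in \<open>A\<close>: choose \<open>f\<close> in \<open>A\<close> equal to \<open>1\<close> on the block, and \<open>h\<close> in \<open>A\<close> equal to \<open>1\<close> on the
  block and to \<open>0\<close> at the finitely many remaining indices where \<open>|f| \<ge> 1/2\<close>; then
  \<open>f^N h\<close> converges to the indicator, since the error is at most \<open>2^(-N) |h|\<close>.  Finite combinations of
  these indicators approximate every rapidly decreasing sequence that is constant on the blocks and
  vanishes at the common zeros, so \<open>A\<close> consists of all such sequences
  (\<open>closed_star_subalgebra_is_block_algebra\<close>).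

  Such a sequence is determined by its values at the largest index of each block.  These
  values may be prescribed freely among the rapidly decreasing ones, because repeating a
  value at smaller indices of the block does not increase any weighted supremum.  Hence restriction
  to the largest indices \<open>n\<^sub>1 < n\<^sub>2 < \<dots>\<close> is an isomorphism of \<open>A\<close> onto \<open>\<lambda>\<^sup>\<infinity>(n\<^sub>k^q)\<close>, isometric
  for all the supremum norms (\<open>block_algebra_isomorphic_lambda\<close>), and the same repetition
  applied to an arbitrary element of \<open>s\<close> is a continuous projection onto \<open>A\<close>
  (\<open>complemented_block_algebra\<close>).  Conversely, \<open>\<lambda>\<^sup>\<infinity>(n\<^sub>k^q)\<close> is isomorphic to the algebra of sequences in \<open>s\<close>
  supported on \<open>{n\<^sub>1, n\<^sub>2, \<dots>}\<close>, where all blocks are singletons.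
\<close>


section \<open>Weighted supremum norms\<close>

lemma lambda_spaceI:
  assumes "\<And>q. \<exists>B. \<forall>k. cmod (\<xi> k) * real (n k) ^ q \<le> B"
  shows "\<xi> \<in> lambda_space n"
  unfolding lambda_space_def bdd_above_def using assms by fastforce

lemma lambda_norm_upper:
  assumes "\<xi> \<in> lambda_space n"
  shows "cmod (\<xi> k) * real (n k) ^ q \<le> lambda_norm n q \<xi>"
  unfolding lambda_norm_def
  by (rule cSUP_upper) (use assms in \<open>auto simp: lambda_space_def\<close>)

lemma lambda_norm_least:
  assumes "\<And>k. cmod (\<xi> k) * real (n k) ^ q \<le> B"
  shows "lambda_norm n q \<xi> \<le> B"
  unfolding lambda_norm_def by (rule cSUP_least) (use assms in auto)

lemma lambda_norm_zero [simp]: "lambda_norm n q 0 = 0"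
  by (simp add: lambda_norm_def)

lemma lambda_norm_nonneg:
  assumes "\<xi> \<in> lambda_space n"
  shows "0 \<le> lambda_norm n q \<xi>"
  by (rule order_trans[OF _ lambda_norm_upper[OF assms, of undefined]]) simp

lemma cmod_le_lambda_norm:
  assumes "\<xi> \<in> lambda_space n"
  shows "cmod (\<xi> k) \<le> lambda_norm n 0 \<xi>"
  using lambda_norm_upper[OF assms, of k 0] by simp

lemma lambda_space_solid:
  assumes \<xi>: "\<xi> \<in> lambda_space n" and c: "c \<ge> 0"
    and le: "\<And>k. cmod (\<eta> k) \<le> c * cmod (\<xi> k)"
  shows "\<eta> \<in> lambda_space n" and "lambda_norm n q \<eta> \<le> c * lambda_norm n q \<xi>"
proof -
  have *: "cmod (\<eta> k) * real (n k) ^ q \<le> c * lambda_norm n q \<xi>" for q k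
  proof -
    have "cmod (\<eta> k) * real (n k) ^ q \<le> c * (cmod (\<xi> k) * real (n k) ^ q)"
      using mult_right_mono[OF le[of k], of "real (n k) ^ q"] by (simp add: mult.assoc)
    also have "\<dots> \<le> c * lambda_norm n q \<xi>"
      using c lambda_norm_upper[OF \<xi>] by (simp add: mult_left_mono)
    finally show ?thesis .
  qed
  show "\<eta> \<in> lambda_space n"
    by (rule lambda_spaceI) (use * in blast)
  show "lambda_norm n q \<eta> \<le> c * lambda_norm n q \<xi>"
    by (rule lambda_norm_least) (rule *)
qed

lemma lambda_space_add:
  assumes x: "x \<in> lambda_space n" and y: "y \<in> lambda_space n"
  shows "x + y \<in> lambda_space n"
    and "lambda_norm n q (x + y) \<le> lambda_norm n q x + lambda_norm n q y"
proof -
  have *: "cmod ((x + y) k) * real (n k) ^ q \<le> lambda_norm n q x + lambda_norm n q y" for q k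
  proof -
    have "cmod ((x + y) k) * real (n k) ^ q \<le> (cmod (x k) + cmod (y k)) * real (n k) ^ q"
      by (intro mult_right_mono) (auto intro: norm_triangle_ineq)
    also have "\<dots> \<le> lambda_norm n q x + lambda_norm n q y"
      using lambda_norm_upper[OF x, of k q] lambda_norm_upper[OF y, of k q]
      by (simp add: distrib_right)
    finally show ?thesis .
  qed
  show "x + y \<in> lambda_space n"
    by (rule lambda_spaceI) (use * in blast)
  show "lambda_norm n q (x + y) \<le> lambda_norm n q x + lambda_norm n q y"
    by (rule lambda_norm_least) (rule *)
qed

lemma lambda_space_cscale:
  assumes "x \<in> lambda_space n" shows "cscale c x \<in> lambda_space n"
  by (rule lambda_space_solid(1)[OF assms, of "cmod c"]) (auto simp: cscale_def norm_mult)

lemma subspace_lambda_space: "cseq.subspace (lambda_space n)"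
  unfolding cseq.subspace_def
  by (auto intro: lambda_space_add lambda_space_cscale) (auto simp: lambda_space_def)

lemma lambda_space_mult:
  assumes x: "x \<in> lambda_space n" and y: "y \<in> lambda_space n"
  shows "x * y \<in> lambda_space n"
  by (rule lambda_space_solid(1)[OF y lambda_norm_nonneg[OF x, of 0]])
     (auto simp: norm_mult intro!: mult_right_mono cmod_le_lambda_norm[OF x])

lemma lambda_space_star:
  assumes "x \<in> lambda_space n" shows "star x \<in> lambda_space n"
  by (rule lambda_space_solid(1)[OF assms, of 1]) (auto simp: star_def)


section \<open>Topologies generated by seminorms\<close>

lemma openin_seminorm_ball:
  assumes "\<xi> \<in> X" "e > 0"
  shows "openin (seminorm_topology X p) {\<eta> \<in> X. p q (\<eta> - \<xi>) < e}"
  unfolding seminorm_topology_def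
  by (rule topology_generated_by_Basis) (use assms in blast)

text \<open>
  By linearity and the triangle inequality, an estimate of seminorms at the origin controls the
  preimage of a ball around every one of its points, whatever the centre of the ball is.
\<close>
lemma continuous_map_seminorm_topology:
  assumes X: "cseq.subspace X" and Y: "cseq.subspace Y"
    and p0: "\<And>q. p q 0 = 0" and p'0: "\<And>q. p' q 0 = 0"
    and tri: "\<And>q x y. x \<in> Y \<Longrightarrow> y \<in> Y \<Longrightarrow> p' q (x + y) \<le> p' q x + p' q y"
    and lin: "linear_map_on X f" and im: "f ` X \<subseteq> Y"
    and bound: "\<And>q. \<exists>r c. c > 0 \<and> (\<forall>x\<in>X. p' q (f x) \<le> c * p r x)"
  shows "continuous_map (seminorm_topology X p) (seminorm_topology Y p') f"
proof -
  have "openin (seminorm_topology X p) {x \<in> X. p' q (f x - z) < e}" if z: "z \<in> Y" for q z e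
  proof (subst openin_subopen, safe)
    fix x assume x: "x \<in> X" and less: "p' q (f x - z) < e"
    obtain r c where c: "c > 0" and le: "\<forall>x\<in>X. p' q (f x) \<le> c * p r x"
      using bound by blast
    define d where "d = (e - p' q (f x - z)) / c"
    have d: "d > 0" using less c by (simp add: d_def)
    have "{y \<in> X. p r (y - x) < d} \<subseteq> {x \<in> X. p' q (f x - z) < e}"
    proof safe
      fix y assume y: "y \<in> X" and yd: "p r (y - x) < d"
      have yx: "y - x \<in> X" using X y x by (rule cseq.subspace_diff)
      have "f y = f ((y - x) + x)" by simp
      also have "\<dots> = f (y - x) + f x"
        using lin yx x unfolding linear_map_on_def by blast
      finally have "f y - z = f (y - x) + (f x - z)" by simp
      then have "p' q (f y - z) \<le> p' q (f (y - x)) + p' q (f x - z)"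
        using tri[of "f (y - x)" "f x - z" q] im yx x z Y cseq.subspace_diff
        by (metis image_subset_iff)
      moreover have "p' q (f (y - x)) < c * d"
        using le yx yd c by (meson le_less_trans mult_strict_left_mono)
      ultimately show "p' q (f y - z) < e" using c by (simp add: d_def)
    qed
    then show "\<exists>T. openin (seminorm_topology X p) T \<and> x \<in> T \<and> T \<subseteq> {x \<in> X. p' q (f x - z) < e}"
      using openin_seminorm_ball[OF x d, of p r] x d p0 by (intro exI[of _ "{y \<in> X. p r (y - x) < d}"]) auto
  qed
  moreover have "f -` {\<eta> \<in> Y. p' q (\<eta> - z) < e} \<inter> X = {x \<in> X. p' q (f x - z) < e}" for q z e
    using im by auto
  ultimately have "\<forall>U. U \<in> {{\<eta> \<in> Y. p' q (\<eta> - z) < e} |q z e. z \<in> Y \<and> e > 0} \<longrightarrow>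
      openin (seminorm_topology X p) (f -` U \<inter> X)"
    by fastforce
  moreover have "f ` X \<subseteq> topspace (seminorm_topology Y p')"
    using im topspace_seminorm_topology[of p' Y] p'0 by simp
  ultimately show ?thesis
    unfolding seminorm_topology_def[of Y] continuous_on_generated_topo_iff
    by (simp add: topspace_seminorm_topology[of p X] p0)
qed

text \<open>
  Eventual membership passes through the finite intersections and the unions that generate the
  open sets, so it only has to be checked for the balls of the subbase.
\<close>
lemma limitin_seminorm_topology:
  assumes X: "cseq.subspace X" and p0: "\<And>q. p q 0 = 0"
    and tri: "\<And>q x y. x \<in> X \<Longrightarrow> y \<in> X \<Longrightarrow> p q (x + y) \<le> p q x + p q y"
    and l: "l \<in> X" and u: "\<And>n. u n \<in> X" and lim: "\<And>q. (\<lambda>n. p q (u n - l)) \<longlonglongrightarrow> 0"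
  shows "limitin (seminorm_topology X p) u l sequentially"
proof -
  have "l \<in> U \<longrightarrow> (\<forall>\<^sub>F n in sequentially. u n \<in> U)"
    if "generate_topology_on {{\<eta> \<in> X. p q (\<eta> - \<xi>) < e} | q \<xi> e. \<xi> \<in> X \<and> e > 0} U" for U
    using that
  proof induction
    case (Int a b)
    then show ?case by (auto simp: eventually_conj_iff)
  next
    case (UN K)
    then show ?case by (smt (verit, ccfv_SIG) Union_iff eventually_mono)
  next
    case (Basis s)
    then obtain q \<xi> e where s: "s = {\<eta> \<in> X. p q (\<eta> - \<xi>) < e}" and \<xi>: "\<xi> \<in> X" by blast
    show ?case
    proof
      assume "l \<in> s"
      then have "0 < e - p q (l - \<xi>)" by (simp add: s)
      from order_tendstoD(2)[OF lim[of q] this]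
      show "\<forall>\<^sub>F n in sequentially. u n \<in> s"
      proof eventually_elim
        case (elim n)
        have "u n - \<xi> = (u n - l) + (l - \<xi>)" by simp
        then have "p q (u n - \<xi>) \<le> p q (u n - l) + p q (l - \<xi>)"
          using tri[of "u n - l" "l - \<xi>" q] X u l \<xi> by (metis cseq.subspace_diff)
        with elim show ?case by (simp add: s u)
      qed
    qed
  qed auto
  then show ?thesis
    unfolding limitin_def using l topspace_seminorm_topology[of p X, OF p0]
    by (auto simp: seminorm_topology_def openin_topology_generated_by_iff)
qed

lemma continuous_map_lambda_topology:
  assumes "linear_map_on (lambda_space n) f" "f ` lambda_space n \<subseteq> lambda_space m"
    and "\<And>q x. x \<in> lambda_space n \<Longrightarrow> lambda_norm m q (f x) \<le> lambda_norm n q x"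
  shows "continuous_map (lambda_topology n) (lambda_topology m) f"
  unfolding lambda_topology_def
proof (rule continuous_map_seminorm_topology)
  show "\<exists>r c. c > 0 \<and> (\<forall>x\<in>lambda_space n. lambda_norm m q (f x) \<le> c * lambda_norm n r x)" for q
    using assms(3)[of _ q] by (intro exI[of _ q] exI[of _ 1]) auto
qed (use assms in \<open>auto intro: lambda_space_add subspace_lambda_space\<close>)


section \<open>Rapidly decreasing sequences\<close>

lemma cmod_weight_le_s_norm:
  assumes "\<xi> \<in> s_space"
  shows "cmod (\<xi> k) * real (Suc k) ^ q \<le> s_norm q \<xi>"
proof -
  let ?g = "\<lambda>i. (cmod (\<xi> i))\<^sup>2 * real (Suc i) ^ (2 * q)"
  have "sum ?g {k} \<le> suminf ?g"
    by (rule sum_le_suminf) (use assms in \<open>auto simp: s_space_def\<close>)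
  then have "sqrt ((cmod (\<xi> k) * real (Suc k) ^ q)\<^sup>2) \<le> s_norm q \<xi>"
    by (simp add: s_norm_def power_mult_distrib power_mult[symmetric] mult.commute[of q])
  then show ?thesis by simp
qed

text \<open>
  One extra power of the weight, squared, pays for the convergent series \<open>\<Sum> 1/j\<^sup>2 = \<pi>\<^sup>2/6\<close>; the
  constant is rounded up to \<open>\<pi>\<close>.
\<close>
lemma lambda_norm_controls_s_norm:
  assumes "\<xi> \<in> lambda_space Suc"
  shows "summable (\<lambda>i. (cmod (\<xi> i))\<^sup>2 * real (Suc i) ^ (2 * q))"
    and "s_norm q \<xi> \<le> pi * lambda_norm Suc (Suc q) \<xi>"
proof -
  let ?B = "lambda_norm Suc (Suc q) \<xi>"
  let ?g = "\<lambda>i. (cmod (\<xi> i))\<^sup>2 * real (Suc i) ^ (2 * q)"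
  let ?h = "\<lambda>i. ?B\<^sup>2 * (1 / (real i + 1)\<^sup>2)"
  have sh: "?h sums (?B\<^sup>2 * (pi\<^sup>2 / 6))"
    using inverse_squares_sums by (intro sums_mult) (simp add: add.commute)
  have gh: "?g i \<le> ?h i" for i
  proof -
    have "(cmod (\<xi> i) * real (Suc i) ^ Suc q)\<^sup>2 \<le> ?B\<^sup>2"
      by (intro power_mono lambda_norm_upper assms) simp
    then have "?g i * (real i + 1)\<^sup>2 \<le> ?B\<^sup>2"
      by (simp add: power_mult_distrib power_mult[symmetric] mult_ac add.commute)
    then show ?thesis by (simp add: field_simps)
  qed
  show s: "summable ?g"
    by (rule summable_comparison_test[OF _ sums_summable[OF sh]]) (use gh in auto)
  have "suminf ?g \<le> ?B\<^sup>2 * (pi\<^sup>2 / 6)"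
    using suminf_le[OF gh s sums_summable[OF sh]] sums_unique[OF sh] by simp
  also have "\<dots> \<le> (pi * ?B)\<^sup>2"
    by (simp add: power_mult_distrib)
  finally have "s_norm q \<xi> \<le> sqrt ((pi * ?B)\<^sup>2)"
    unfolding s_norm_def by (rule real_sqrt_le_mono)
  then show "s_norm q \<xi> \<le> pi * ?B"
    using lambda_norm_nonneg[OF assms] by simp
qed

lemma s_space_eq: "s_space = lambda_space Suc"
proof
  show "s_space \<subseteq> lambda_space Suc"
    using cmod_weight_le_s_norm by (blast intro: lambda_spaceI)
  show "lambda_space Suc \<subseteq> s_space"
    using lambda_norm_controls_s_norm(1) by (auto simp: s_space_def)
qed

text \<open>Minkowski's inequality for the partial sums, in the limit.\<close>
lemma s_norm_triangle:
  assumes x: "x \<in> s_space" and y: "y \<in> s_space"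
  shows "s_norm q (x + y) \<le> s_norm q x + s_norm q y"
proof -
  let ?w = "\<lambda>f i. cmod (f i) * real (Suc i) ^ q"
  have sq: "(?w f i)\<^sup>2 = (cmod (f i))\<^sup>2 * real (Suc i) ^ (2 * q)" for f :: cseq and i
    by (simp add: power_mult_distrib power_mult[symmetric] mult.commute[of q])
  have lim: "(\<lambda>N. L2_set (?w f) {..<N}) \<longlonglongrightarrow> s_norm q f" if "f \<in> s_space" for f
    unfolding L2_set_def s_norm_def sq
    by (intro tendsto_real_sqrt summable_LIMSEQ) (use that in \<open>auto simp: s_space_def\<close>)
  have "x + y \<in> s_space"
    using x y lambda_space_add(1) by (simp add: s_space_eq)
  moreover have "L2_set (?w (x + y)) {..<N} \<le> L2_set (?w x) {..<N} + L2_set (?w y) {..<N}" for N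
  proof -
    have "L2_set (?w (x + y)) {..<N} \<le> L2_set (\<lambda>i. ?w x i + ?w y i) {..<N}"
    proof (rule L2_set_mono)
      fix i
      have "?w (x + y) i \<le> (cmod (x i) + cmod (y i)) * real (Suc i) ^ q"
        by (intro mult_right_mono) (auto intro: norm_triangle_ineq)
      then show "?w (x + y) i \<le> ?w x i + ?w y i" by (simp only: distrib_right)
    qed simp
    also have "\<dots> \<le> L2_set (?w x) {..<N} + L2_set (?w y) {..<N}"
      by (rule L2_set_triangle_ineq)
    finally show ?thesis .
  qed
  ultimately show ?thesis
    by (intro LIMSEQ_le[OF lim tendsto_add[OF lim[OF x] lim[OF y]]]) auto
qed

lemma s_topology_eq: "s_topology = lambda_topology Suc"
proof -
  have lin: "linear_map_on V id" for V by (simp add: linear_map_on_def)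
  have "continuous_map s_topology (lambda_topology Suc) id"
    unfolding s_topology_def lambda_topology_def
  proof (rule continuous_map_seminorm_topology[OF _ _ _ _ _ lin])
    show "\<exists>r c. c > 0 \<and> (\<forall>x\<in>s_space. lambda_norm Suc q (id x) \<le> c * s_norm r x)" for q
      by (intro exI[of _ q] exI[of _ 1])
         (auto intro: lambda_norm_least cmod_weight_le_s_norm)
  qed (auto simp: s_space_eq s_norm_def intro: subspace_lambda_space lambda_space_add)
  moreover have "continuous_map (lambda_topology Suc) s_topology id"
    unfolding s_topology_def lambda_topology_def
  proof (rule continuous_map_seminorm_topology[OF _ _ _ _ _ lin])
    show "\<exists>r c. c > 0 \<and> (\<forall>x\<in>lambda_space Suc. s_norm q (id x) \<le> c * lambda_norm Suc r x)" for q
      by (intro exI[of _ "Suc q"] exI[of _ pi])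
         (auto intro: lambda_norm_controls_s_norm(2))
  qed (use s_norm_triangle in \<open>auto simp: s_space_eq s_norm_def intro: subspace_lambda_space\<close>)
  ultimately have "homeomorphic_maps s_topology (lambda_topology Suc) id id"
    by (simp add: homeomorphic_maps_def)
  then show ?thesis
    using homeomorphic_maps_id by metis
qed

section \<open>Algebras of sequences that are constant on finite blocks\<close>

text \<open>
  A partition of a set of indices into finite blocks is encoded by the map that sends an index to
  the largest index of its block, and to \<open>None\<close> where all sequences of the algebra vanish.
\<close>
definition block_map :: "(nat \<Rightarrow> nat option) \<Rightarrow> bool" where
  "block_map \<rho> \<longleftrightarrow> (\<forall>i j. \<rho> i = Some j \<longrightarrow> i \<le> j \<and> \<rho> j = Some j)"

definition block_tops :: "(nat \<Rightarrow> nat option) \<Rightarrow> nat set" where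
  "block_tops \<rho> = {j. \<rho> j = Some j}"

definition spread :: "(nat \<Rightarrow> nat option) \<Rightarrow> cseq \<Rightarrow> cseq" where
  "spread \<rho> f = (\<lambda>i. case \<rho> i of None \<Rightarrow> 0 | Some j \<Rightarrow> f j)"

definition block_algebra :: "(nat \<Rightarrow> nat option) \<Rightarrow> cseq set" where
  "block_algebra \<rho> = {f \<in> s_space. spread \<rho> f = f}"

lemma spread_add: "spread \<rho> (f + g) = spread \<rho> f + spread \<rho> g"
  and spread_mult: "spread \<rho> (f * g) = spread \<rho> f * spread \<rho> g"
  and spread_cscale: "spread \<rho> (cscale c f) = cscale c (spread \<rho> f)"
  and spread_star: "spread \<rho> (star f) = star (spread \<rho> f)"
  by (auto simp: spread_def cscale_def star_def fun_eq_iff split: option.splits)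

lemma spread_zero [simp]: "spread \<rho> 0 = 0"
  by (auto simp: spread_def fun_eq_iff split: option.splits)

lemma spread_idem:
  assumes "block_map \<rho>" shows "spread \<rho> (spread \<rho> f) = spread \<rho> f"
  using assms by (auto simp: spread_def block_map_def fun_eq_iff split: option.splits)

lemma spread_cong:
  assumes "block_map \<rho>" "\<And>j. j \<in> block_tops \<rho> \<Longrightarrow> f j = g j"
  shows "spread \<rho> f = spread \<rho> g"
  using assms by (auto simp: spread_def block_map_def block_tops_def fun_eq_iff split: option.splits)

lemma spread_at_top:
  assumes "j \<in> block_tops \<rho>" shows "spread \<rho> f j = f j"
  using assms by (simp add: spread_def block_tops_def)

text \<open>
  This is why blocks are represented by their largest index: the weight there dominates the
  weights on the whole block, so the bound loses no constant and no power of the weight, however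
  large the blocks are.
\<close>
lemma spread_weight_le:
  assumes \<rho>: "block_map \<rho>" and B: "B \<ge> 0"
    and le: "\<And>j. j \<in> block_tops \<rho> \<Longrightarrow> cmod (f j) * real (Suc j) ^ q \<le> B"
  shows "cmod (spread \<rho> f i) * real (Suc i) ^ q \<le> B"
proof (cases "\<rho> i")
  case (Some j)
  then have j: "i \<le> j" "j \<in> block_tops \<rho>"
    using \<rho> by (auto simp: block_map_def block_tops_def)
  have "cmod (spread \<rho> f i) * real (Suc i) ^ q \<le> cmod (f j) * real (Suc j) ^ q"
    using j by (auto simp: spread_def Some intro!: mult_left_mono power_mono)
  then show ?thesis using le[OF j(2)] by linarith
qed (simp add: spread_def B)

lemma spread_in_s_space:
  assumes \<rho>: "block_map \<rho>" and f: "f \<in> s_space"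
  shows "spread \<rho> f \<in> s_space"
    and "lambda_norm Suc q (spread \<rho> f) \<le> lambda_norm Suc q f"
proof -
  have f': "f \<in> lambda_space Suc" using f by (simp add: s_space_eq)
  have *: "cmod (spread \<rho> f i) * real (Suc i) ^ q \<le> lambda_norm Suc q f" for q i
    by (rule spread_weight_le[OF \<rho> lambda_norm_nonneg[OF f'] lambda_norm_upper[OF f']])
  show "spread \<rho> f \<in> s_space"
    unfolding s_space_eq by (rule lambda_spaceI) (use * in blast)
  show "lambda_norm Suc q (spread \<rho> f) \<le> lambda_norm Suc q f"
    by (rule lambda_norm_least) (rule *)
qed

lemma image_spread:
  assumes "block_map \<rho>" shows "spread \<rho> ` s_space = block_algebra \<rho>"
proof
  show "spread \<rho> ` s_space \<subseteq> block_algebra \<rho>"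
    using assms by (auto simp: block_algebra_def spread_idem spread_in_s_space)
  show "block_algebra \<rho> \<subseteq> spread \<rho> ` s_space"
    unfolding block_algebra_def by force
qed

lemma continuous_map_spread:
  assumes "block_map \<rho>" shows "continuous_map s_topology s_topology (spread \<rho>)"
  unfolding s_topology_eq
  by (rule continuous_map_lambda_topology)
     (use assms spread_in_s_space in
       \<open>auto simp: linear_map_on_def spread_add spread_cscale simp flip: s_space_eq\<close>)

lemma complemented_block_algebra:
  assumes "block_map \<rho>" shows "complemented_subspace s_topology (block_algebra \<rho>)"
  unfolding complemented_subspace_def
  by (rule exI[of _ "spread \<rho>"])
     (use assms in \<open>simp add: continuous_map_spread linear_map_on_def spread_add spread_cscale
        spread_idem image_spread\<close>)

lemma limitin_s_topology:
  assumes l: "l \<in> s_space" and u: "\<And>n. u n \<in> s_space"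
    and lim: "\<And>q. (\<lambda>n. lambda_norm Suc q (u n - l)) \<longlonglongrightarrow> 0"
  shows "limitin s_topology u l sequentially"
  unfolding s_topology_eq lambda_topology_def
  by (rule limitin_seminorm_topology)
     (use assms in \<open>auto simp: s_space_eq intro: subspace_lambda_space lambda_space_add\<close>)

text \<open>
  If some coordinate violates \<open>spread \<rho> f = f\<close>, the violation persists under small perturbations in
  the plain supremum norm, since that norm controls both coordinates involved.
\<close>
lemma closedin_block_algebra: "closedin s_topology (block_algebra \<rho>)"
proof -
  have "openin s_topology (s_space - block_algebra \<rho>)"
  proof (subst openin_subopen, safe)
    fix f assume f: "f \<in> s_space" "f \<notin> block_algebra \<rho>"
    then obtain i where i: "spread \<rho> f i \<noteq> f i"
      by (auto simp: block_algebra_def fun_eq_iff)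
    define d where "d = cmod (spread \<rho> f i - f i) / 2"
    have d: "d > 0" using i by (simp add: d_def)
    let ?T = "{g \<in> s_space. lambda_norm Suc 0 (g - f) < d}"
    have "openin s_topology ?T"
      unfolding s_topology_eq lambda_topology_def s_space_eq
      by (rule openin_seminorm_ball) (use f d in \<open>auto simp: s_space_eq\<close>)
    moreover have "f \<in> ?T" using f d by simp
    moreover have "g \<notin> block_algebra \<rho>" if g: "g \<in> ?T" for g
    proof
      assume "g \<in> block_algebra \<rho>"
      then have eq: "spread \<rho> g i = g i" by (simp add: block_algebra_def fun_eq_iff)
      have gf: "g - f \<in> lambda_space Suc"
        using g f cseq.subspace_diff[OF subspace_lambda_space] by (simp add: s_space_eq)
      have near: "cmod (g k - f k) < d" for k
        using cmod_le_lambda_norm[OF gf, of k] g by simp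
      have "cmod (spread \<rho> g i - spread \<rho> f i) < d"
        using near d by (auto simp: spread_def split: option.splits)
      moreover have "spread \<rho> f i - f i = (g i - f i) - (spread \<rho> g i - spread \<rho> f i)"
        by (simp add: eq)
      then have "2 * d \<le> cmod (g i - f i) + cmod (spread \<rho> g i - spread \<rho> f i)"
        unfolding d_def by (metis norm_triangle_ineq4 times_divide_eq_right nonzero_mult_div_cancel_left zero_neq_numeral)
      ultimately show False using near[of i] by linarith
    qed
    ultimately show "\<exists>T. openin s_topology T \<and> f \<in> T \<and> T \<subseteq> s_space - block_algebra \<rho>"
      by blast
  qed
  then show ?thesis
    by (auto simp: closedin_def block_algebra_def)
qed

lemma closed_star_subalgebra_block_algebra:
  "closed_star_subalgebra s_topology (block_algebra \<rho>)"
  unfolding closed_star_subalgebra_def cseq.subspace_def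
proof (intro conjI ballI allI)
  show "closedin s_topology (block_algebra \<rho>)" by (rule closedin_block_algebra)
  show "0 \<in> block_algebra \<rho>"
    using cseq.subspace_0[OF subspace_lambda_space] by (simp add: block_algebra_def s_space_eq)
qed (auto simp: block_algebra_def s_space_eq spread_add spread_mult spread_cscale spread_star
      lambda_space_add(1) lambda_space_mult lambda_space_star lambda_space_cscale)

definition block_indicator :: "(nat \<Rightarrow> nat option) \<Rightarrow> nat \<Rightarrow> cseq" where
  "block_indicator \<rho> j = spread \<rho> (\<lambda>k. if k = j then 1 else 0)"

lemma block_indicator_at_top:
  assumes "k \<in> block_tops \<rho>"
  shows "block_indicator \<rho> j k = (if k = j then 1 else 0)"
  using spread_at_top[OF assms] by (simp add: block_indicator_def)

lemma block_indicator_in_block_algebra: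
  assumes "block_map \<rho>" shows "block_indicator \<rho> j \<in> block_algebra \<rho>"
proof -
  have "(\<lambda>k. if k = j then 1 else 0) \<in> s_space"
    unfolding s_space_eq
  proof (rule lambda_spaceI)
    fix q
    show "\<exists>B. \<forall>k. cmod (if k = j then 1 else 0) * real (Suc k) ^ q \<le> B"
      by (rule exI[of _ "real (Suc j) ^ q"]) auto
  qed
  then show ?thesis
    using image_spread[OF assms] by (auto simp: block_indicator_def)
qed

lemma sum_fun_apply: "sum F I k = (\<Sum>j\<in>I. F j k)"
  for F :: "'b \<Rightarrow> cseq"
  by (induction I rule: infinite_finite_induct) auto

text \<open>
  The indicators of the blocks are linearly independent, and span the algebra when there are only
  finitely many of them.
\<close>
lemma infinite_dimensional_block_algebra:
  assumes \<rho>: "block_map \<rho>"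
  shows "infinite_dimensional (block_algebra \<rho>) \<longleftrightarrow> infinite (block_tops \<rho>)"
proof
  let ?e = "block_indicator \<rho>"
  assume inf: "infinite_dimensional (block_algebra \<rho>)"
  show "infinite (block_tops \<rho>)"
  proof
    assume fin: "finite (block_tops \<rho>)"
    have sub: "?e ` block_tops \<rho> \<subseteq> block_algebra \<rho>"
      using block_indicator_in_block_algebra[OF \<rho>] by blast
    have "block_algebra \<rho> \<subseteq> cseq.span (?e ` block_tops \<rho>)"
    proof
      fix f assume f: "f \<in> block_algebra \<rho>"
      let ?g = "\<Sum>j\<in>block_tops \<rho>. cscale (f j) (?e j)"
      have g: "?g \<in> cseq.span (?e ` block_tops \<rho>)"
        by (intro cseq.span_sum cseq.span_scale cseq.span_base) auto
      have "?g k = f k" if "k \<in> block_tops \<rho>" for k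
        using fin that
        by (simp add: sum_fun_apply cscale_def block_indicator_at_top if_distrib cong: if_cong)
      then have "spread \<rho> ?g = spread \<rho> f" by (rule spread_cong[OF \<rho>])
      moreover have "?g \<in> block_algebra \<rho>"
        using g sub closed_star_subalgebra_block_algebra[of \<rho>]
        by (meson closed_star_subalgebra_def cseq.span_minimal subsetD)
      ultimately have "?g = f" using f by (simp add: block_algebra_def)
      then show "f \<in> cseq.span (?e ` block_tops \<rho>)" using g by simp
    qed
    moreover have "cseq.span (?e ` block_tops \<rho>) \<subseteq> block_algebra \<rho>"
      using sub closed_star_subalgebra_block_algebra[of \<rho>]
      by (meson closed_star_subalgebra_def cseq.span_minimal)
    ultimately show False
      using inf fin sub unfolding infinite_dimensional_def by blast
  qed
next
  let ?e = "block_indicator \<rho>"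
  assume inf: "infinite (block_tops \<rho>)"
  have inj: "inj_on ?e (block_tops \<rho>)"
    by (rule inj_onI) (metis block_indicator_at_top zero_neq_one)
  have "cseq.independent (?e ` block_tops \<rho>)"
    unfolding cseq.independent_explicit_module
  proof (intro allI impI)
    fix t u v
    assume t: "finite t" "t \<subseteq> ?e ` block_tops \<rho>" "(\<Sum>w\<in>t. cscale (u w) w) = 0" "v \<in> t"
    then obtain j where j: "j \<in> block_tops \<rho>" "v = ?e j" by blast
    have at: "w j = (if w = v then 1 else 0)" if "w \<in> t" for w
    proof -
      obtain i where "i \<in> block_tops \<rho>" "w = ?e i" using \<open>w \<in> t\<close> t(2) by blast
      then show ?thesis
        using j inj by (auto simp: block_indicator_at_top dest: inj_onD)
    qed
    have "0 = (\<Sum>w\<in>t. cscale (u w) w) j" by (simp add: t)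
    also have "\<dots> = (\<Sum>w\<in>t. if w = v then u w else 0)"
      unfolding sum_fun_apply cscale_def by (rule sum.cong) (auto simp: at)
    also have "\<dots> = u v" using t by simp
    finally show "u v = 0" by simp
  qed
  then have "finite (?e ` block_tops \<rho>)" if "finite B" "cseq.span B = block_algebra \<rho>" for B
    using cseq.independent_span_bound[OF that(1)] that(2) block_indicator_in_block_algebra[OF \<rho>]
    by blast
  then show "infinite_dimensional (block_algebra \<rho>)"
    unfolding infinite_dimensional_def using inf inj finite_imageD by blast
qed

text \<open>
  Restriction to the largest indices of the blocks and repetition along the blocks are mutually
  inverse, and neither increases a weighted supremum norm.  The shift in \<open>n k = Suc (m k)\<close> is there
  because position \<open>i\<close> of a sequence carries the weight \<open>Suc i\<close>.
\<close>
lemma block_algebra_isomorphic_lambda: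
  assumes \<rho>: "block_map \<rho>" and m: "inj m" "range m = block_tops \<rho>"
    and n: "\<And>k. n k = Suc (m k)"
  shows "frechet_star_isomorphic (subtopology s_topology (block_algebra \<rho>)) (lambda_topology n)"
    and "frechet_star_isomorphic (lambda_topology n) (subtopology s_topology (block_algebra \<rho>))"
proof -
  define \<phi> :: "cseq \<Rightarrow> cseq" where "\<phi> f = (\<lambda>k. f (m k))" for f
  define \<psi> :: "cseq \<Rightarrow> cseq" where "\<psi> \<xi> = spread \<rho> (\<lambda>j. \<xi> (inv m j))" for \<xi>
  let ?A = "subtopology s_topology (block_algebra \<rho>)"
  have A: "topspace ?A = block_algebra \<rho>" by (auto simp: block_algebra_def)
  have \<phi>_weight: "cmod (\<phi> f k) * real (n k) ^ q \<le> lambda_norm Suc q f"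
    if "f \<in> lambda_space Suc" for f k q
    using lambda_norm_upper[OF that, of "m k" q] by (simp add: \<phi>_def n)
  have \<psi>_weight: "cmod (\<psi> \<xi> i) * real (Suc i) ^ q \<le> lambda_norm n q \<xi>"
    if \<xi>: "\<xi> \<in> lambda_space n" for \<xi> i q
    unfolding \<psi>_def
  proof (rule spread_weight_le[OF \<rho> lambda_norm_nonneg[OF \<xi>]])
    fix j assume "j \<in> block_tops \<rho>"
    then obtain k where k: "j = m k" using m(2) by blast
    show "cmod (\<xi> (inv m j)) * real (Suc j) ^ q \<le> lambda_norm n q \<xi>"
      using lambda_norm_upper[OF \<xi>, of k q] by (simp add: k m(1) n)
  qed
  have \<phi>_lin: "linear_map_on V \<phi>" and \<psi>_lin: "linear_map_on V \<psi>" for V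
    by (auto simp: linear_map_on_def \<phi>_def \<psi>_def spread_def cscale_def fun_eq_iff split: option.splits)
  have \<phi>_space: "\<phi> f \<in> lambda_space n" if "f \<in> lambda_space Suc" for f
    by (rule lambda_spaceI) (use \<phi>_weight[OF that] in blast)
  have \<psi>_space: "\<psi> \<xi> \<in> lambda_space Suc" if "\<xi> \<in> lambda_space n" for \<xi>
    by (rule lambda_spaceI) (use \<psi>_weight[OF that] in blast)
  have \<psi>_block: "\<psi> \<xi> \<in> block_algebra \<rho>" if "\<xi> \<in> lambda_space n" for \<xi>
    using \<psi>_space[OF that] by (simp add: block_algebra_def s_space_eq \<psi>_def spread_idem \<rho>)
  have "continuous_map ?A (lambda_topology n) \<phi>"
    unfolding s_topology_eq
    by (intro continuous_map_from_subtopology continuous_map_lambda_topology \<phi>_lin)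
       (auto intro: \<phi>_space lambda_norm_least \<phi>_weight)
  moreover have "continuous_map (lambda_topology n) ?A \<psi>"
    unfolding s_topology_eq continuous_map_in_subtopology
    by (intro conjI continuous_map_lambda_topology \<psi>_lin)
       (auto intro: \<psi>_space \<psi>_block lambda_norm_least \<psi>_weight)
  moreover have "\<psi> (\<phi> f) = f" if "f \<in> block_algebra \<rho>" for f
  proof -
    have "\<psi> (\<phi> f) = spread \<rho> f"
      unfolding \<psi>_def \<phi>_def
      by (rule spread_cong[OF \<rho>]) (metis f_inv_into_f m(2))
    with that show ?thesis by (simp add: block_algebra_def)
  qed
  moreover have "\<phi> (\<psi> \<xi>) = \<xi>" for \<xi>
  proof
    fix k
    have "m k \<in> block_tops \<rho>" using m(2) by blast
    then show "\<phi> (\<psi> \<xi>) k = \<xi> k"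
      by (simp add: \<phi>_def \<psi>_def spread_at_top m(1))
  qed
  ultimately have "homeomorphic_maps ?A (lambda_topology n) \<phi> \<psi>"
    unfolding homeomorphic_maps_def A by simp
  then have "homeomorphic_map ?A (lambda_topology n) \<phi>" "homeomorphic_map (lambda_topology n) ?A \<psi>"
    by (auto simp: homeomorphic_maps_map)
  moreover have "\<phi> (f * g) = \<phi> f * \<phi> g" "\<phi> (star f) = star (\<phi> f)"
      "\<psi> (f * g) = \<psi> f * \<psi> g" "\<psi> (star f) = star (\<psi> f)" for f g
    by (auto simp: \<phi>_def \<psi>_def spread_def star_def fun_eq_iff split: option.splits)
  ultimately show "frechet_star_isomorphic ?A (lambda_topology n)"
      and "frechet_star_isomorphic (lambda_topology n) ?A"
    unfolding frechet_star_isomorphic_def using \<phi>_lin \<psi>_lin by blast+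
qed


section \<open>Closed star-subalgebras are block algebras\<close>

context
  fixes A :: "cseq set"
  assumes A: "closed_star_subalgebra s_topology A"
begin

private definition "block i = {j. \<forall>f\<in>A. f j = f i}"

private definition "alive i \<longleftrightarrow> (\<exists>f\<in>A. f i \<noteq> 0)"

private definition "top_of i = (if alive i then Some (Max (block i)) else None)"

private lemma block_eq:
  assumes "j \<in> block i" shows "block j = block i" and "alive j \<longleftrightarrow> alive i"
proof -
  have eq: "f j = f i" if "f \<in> A" for f using assms that unfolding block_def by blast
  show "block j = block i" unfolding block_def by (intro Collect_cong ball_cong) (simp_all only: eq)
  show "alive j \<longleftrightarrow> alive i" unfolding alive_def by (intro bex_cong) (simp_all only: eq)
qed

private lemma subspace_A: "cseq.subspace A"
  using A by (simp add: closed_star_subalgebra_def)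

private lemma mult_A: "f \<in> A \<Longrightarrow> g \<in> A \<Longrightarrow> f * g \<in> A"
  using A by (simp add: closed_star_subalgebra_def)

private lemma A_subset: "A \<subseteq> lambda_space Suc"
  using A closedin_subset[of s_topology A] by (simp add: closed_star_subalgebra_def s_space_eq)

private lemma limit_in_A:
  assumes l: "l \<in> lambda_space Suc" and u: "\<And>n. u n \<in> A"
    and lim: "\<And>q. (\<lambda>n. lambda_norm Suc q (u n - l)) \<longlonglongrightarrow> 0"
  shows "l \<in> A"
proof (rule limitin_closedin)
  show "limitin s_topology u l sequentially"
    by (rule limitin_s_topology) (use assms A_subset in \<open>auto simp: s_space_eq\<close>)
  show "closedin s_topology A" using A by (simp add: closed_star_subalgebra_def)
qed (use u in auto)

private lemma finite_large_values:
  assumes f: "f \<in> lambda_space Suc" and e: "e > 0"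
  shows "finite {j. e \<le> cmod (f j)}"
proof -
  let ?B = "lambda_norm Suc 1 f"
  have "j \<le> nat \<lceil>?B / e\<rceil>" if "e \<le> cmod (f j)" for j
  proof -
    have "e * real (Suc j) \<le> cmod (f j) * real (Suc j) ^ 1"
      using that by (simp add: mult_right_mono)
    also have "\<dots> \<le> ?B" by (rule lambda_norm_upper[OF f])
    finally have "real j \<le> ?B / e" using e by (simp add: field_simps)
    then show ?thesis by linarith
  qed
  then show ?thesis by (auto simp: finite_nat_set_iff_bounded_le)
qed

private lemma finite_block:
  assumes "alive i" shows "finite (block i)"
proof -
  obtain f where f: "f \<in> A" "f i \<noteq> 0" using assms alive_def by blast
  have "block i \<subseteq> {j. cmod (f i) \<le> cmod (f j)}" using f by (auto simp: block_def)
  then show ?thesis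
    using finite_large_values[of f "cmod (f i)"] f A_subset finite_subset by auto
qed

text \<open>
  The points of \<open>F\<close> are removed one at a time: some \<open>g\<close> in the algebra separates the new point from
  \<open>i\<close>, and multiplying by \<open>g - g j\<close> creates a zero there.  The
  sequence \<open>g - g j\<close> tends to \<open>- g j\<close> and so need not belong to the algebra, but its product with
  \<open>h\<close> does.
\<close>
private lemma peak_vanishing_on:
  assumes "alive i" "finite F" "F \<inter> block i = {}"
  shows "\<exists>h\<in>A. h i = 1 \<and> (\<forall>j\<in>F. h j = 0)"
  using assms(2,3)
proof (induction F)
  case empty
  obtain f where f: "f \<in> A" "f i \<noteq> 0" using assms(1) alive_def by blast
  then have "cscale (1 / f i) f \<in> A" using subspace_A by (intro cseq.subspace_scale)
  then show ?case using f by (intro bexI) (auto simp: cscale_def)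
next
  case (insert j F)
  then obtain h where h: "h \<in> A" "h i = 1" "\<forall>j\<in>F. h j = 0" by auto
  from insert.prems obtain g where g: "g \<in> A" "g j \<noteq> g i" by (auto simp: block_def)
  let ?h = "cscale (1 / (g i - g j)) (h * g - cscale (g j) h)"
  have "?h \<in> A"
    using g h subspace_A by (intro cseq.subspace_scale cseq.subspace_diff mult_A)
  moreover have "?h i = 1" "\<forall>k\<in>insert j F. ?h k = 0"
    using g h by (auto simp: cscale_def)
  ultimately show ?case by blast
qed

text \<open>
  Powers of an \<open>f\<close> with value \<open>1\<close> on the block kill the indices where \<open>|f| < 1/2\<close>, and a
  factor \<open>h\<close> kills the finitely many other indices outside the block.  Convergence holds in all
  the norms at once because the error is bounded pointwise by a multiple of \<open>h\<close>.
\<close>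
private lemma indicator_block_in_A:
  assumes i: "alive i"
  shows "(\<lambda>j. if j \<in> block i then 1 else 0) \<in> A"
proof -
  let ?I = "\<lambda>j. if j \<in> block i then 1 else 0 :: complex"
  obtain f where f: "f \<in> A" "f i = 1"
    using peak_vanishing_on[OF i, of "{}"] by auto
  have "finite ({j. 1/2 \<le> cmod (f j)} - block i)"
    using finite_large_values[of f "1/2"] f A_subset by auto
  then obtain h where h: "h \<in> A" "h i = 1"
      "\<forall>j\<in>{j. 1/2 \<le> cmod (f j)} - block i. h j = 0"
    using peak_vanishing_on[OF i, of "{j. 1/2 \<le> cmod (f j)} - block i"] by blast
  have hs: "h \<in> lambda_space Suc" using h A_subset by blast
  define u where "u N = (\<lambda>j. f j ^ N * h j)" for N
  have u: "u N \<in> A" for N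
  proof (induction N)
    case 0 then show ?case using h by (simp add: u_def)
  next
    case (Suc N)
    have "u (Suc N) = f * u N" by (auto simp: u_def fun_eq_iff)
    then show ?case using mult_A[OF f(1) Suc] by (simp only:)
  qed
  have on: "f j = 1 \<and> h j = 1" if "j \<in> block i" for j
    using that f h by (auto simp: block_def)
  have diff: "cmod ((u N - ?I) j) \<le> (1/2) ^ N * cmod (h j)" for N j
  proof (cases "j \<in> block i \<or> 1/2 \<le> cmod (f j)")
    case True
    then have "(u N - ?I) j = 0" using on h by (auto simp: u_def)
    then show ?thesis by simp
  next
    case False
    then have "cmod (f j) ^ N \<le> (1/2) ^ N" by (intro power_mono) auto
    then show ?thesis
      using False by (auto simp: u_def norm_mult norm_power intro: mult_right_mono)
  qed
  show ?thesis
  proof (rule limit_in_A[OF _ u])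
    show "?I \<in> lambda_space Suc"
      by (rule lambda_space_solid(1)[OF hs, of 1]) (auto simp: on)
    fix q
    have diff_s: "u N - ?I \<in> lambda_space Suc"
        "lambda_norm Suc q (u N - ?I) \<le> (1/2) ^ N * lambda_norm Suc q h" for N
      by (rule lambda_space_solid[OF hs _ diff]; simp)+
    show "(\<lambda>N. lambda_norm Suc q (u N - ?I)) \<longlonglongrightarrow> 0"
    proof (rule tendsto_sandwich[OF _ _ tendsto_const])
      show "(\<lambda>N. (1/2) ^ N * lambda_norm Suc q h) \<longlonglongrightarrow> 0"
        by (intro tendsto_mult_left_zero LIMSEQ_realpow_zero) auto
    qed (use diff_s lambda_norm_nonneg in auto)
  qed
qed

text \<open>
  The truncation of \<open>f\<close> to the blocks that meet \<open>{..<N}\<close> is a finite combination of block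
  indicators.  Its error lives on indices beyond \<open>N\<close>, where one power of the weight can be
  traded for a factor \<open>1/N\<close>.
\<close>
private lemma blockwise_constant_in_A:
  assumes f: "f \<in> lambda_space Suc"
    and const: "\<And>i j. alive i \<Longrightarrow> j \<in> block i \<Longrightarrow> f j = f i"
    and zero: "\<And>i. \<not> alive i \<Longrightarrow> f i = 0"
  shows "f \<in> A"
proof -
  define cut where "cut F = (\<lambda>j. if \<exists>i\<in>F. j \<in> block i then f j else 0)" for F :: "nat set"
  have cut: "cut F \<in> A" if "finite F" for F
    using that
  proof (induction F)
    case empty
    have "cut {} = 0" by (auto simp: cut_def fun_eq_iff)
    then show ?case using cseq.subspace_0[OF subspace_A] by (simp only:)
  next
    case (insert i F)
    \<comment> \<open>A summand is added only if \<open>i\<close> lies in a block that \<open>F\<close> has not met, and is no common zero.\<close>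
    consider (dead) "\<not> alive i" | (old) k where "k \<in> F" "i \<in> block k"
      | (new) "alive i" "\<forall>k\<in>F. i \<notin> block k" by blast
    then show ?case
    proof cases
      case dead
      have "f j = 0" if "j \<in> block i" for j
        by (rule zero) (use dead that in \<open>simp add: block_eq\<close>)
      then have "cut (insert i F) = cut F" by (auto simp: cut_def fun_eq_iff)
      then show ?thesis using insert by simp
    next
      case old
      then have "cut (insert i F) = cut F" by (auto simp: cut_def fun_eq_iff block_eq)
      then show ?thesis using insert by simp
    next
      case new
      have disj: "\<not> (\<exists>k\<in>F. j \<in> block k)" if "j \<in> block i" for j
      proof
        assume "\<exists>k\<in>F. j \<in> block k"
        then obtain k where k: "k \<in> F" "j \<in> block k" by blast
        have "i \<in> block i" by (simp add: block_def)
        also have "block i = block k"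
          using block_eq(1)[OF that] block_eq(1)[OF k(2)] by (rule trans[OF sym])
        finally show False using new k by blast
      qed
      have "cut (insert i F) = cut F + cscale (f i) (\<lambda>j. if j \<in> block i then 1 else 0)"
        using disj const[OF new(1)] by (auto simp: cut_def cscale_def fun_eq_iff)
      also have "\<dots> \<in> A"
        using insert.IH indicator_block_in_A[OF new(1)]
        by (intro cseq.subspace_add[OF subspace_A] cseq.subspace_scale[OF subspace_A])
      finally show ?thesis .
    qed
  qed
  show ?thesis
  proof (rule limit_in_A[OF f cut])
    fix q
    let ?B = "lambda_norm Suc (Suc q) f"
    have diff: "cmod ((cut {..<N} - f) j) * real (Suc j) ^ q \<le> ?B / real (Suc N)" for N j
    proof (cases "\<exists>i<N. j \<in> block i")
      case True
      then show ?thesis using lambda_norm_nonneg[OF f] by (auto simp: cut_def)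
    next
      case False
      moreover have "j \<in> block j" by (simp add: block_def)
      ultimately have "N \<le> j" using not_le by blast
      have "cmod (f j) * real (Suc j) ^ q * real (Suc N) \<le> cmod (f j) * real (Suc j) ^ q * real (Suc j)"
        using \<open>N \<le> j\<close> by (intro mult_left_mono) auto
      also have "\<dots> \<le> ?B"
        using lambda_norm_upper[OF f, of j "Suc q"] by (simp add: mult_ac)
      finally have "cmod (f j) * real (Suc j) ^ q \<le> ?B / real (Suc N)"
        by (simp only: pos_le_divide_eq of_nat_0_less_iff zero_less_Suc)
      moreover have "cmod ((cut {..<N} - f) j) = cmod (f j)"
        using False by (simp add: cut_def)
      ultimately show ?thesis by (simp only:)
    qed
    have "cut {..<N} - f \<in> lambda_space Suc" for N
      using cut[of "{..<N}"] A_subset f by (intro cseq.subspace_diff[OF subspace_lambda_space]) auto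
    then have lower: "0 \<le> lambda_norm Suc q (cut {..<N} - f)" for N
      by (rule lambda_norm_nonneg)
    have upper: "lambda_norm Suc q (cut {..<N} - f) \<le> ?B / real (Suc N)" for N
      by (rule lambda_norm_least) (rule diff)
    have "(\<lambda>N. ?B / real (Suc N)) \<longlonglongrightarrow> 0"
      by (rule LIMSEQ_Suc[OF lim_const_over_n])
    then show "(\<lambda>N. lambda_norm Suc q (cut {..<N} - f)) \<longlonglongrightarrow> 0"
      by (rule tendsto_sandwich[OF _ _ tendsto_const, rotated -1])
         (simp_all add: lower upper del: of_nat_Suc)
  qed simp
qed

lemma closed_star_subalgebra_is_block_algebra:
  obtains \<rho> where "block_map \<rho>" "A = block_algebra \<rho>"
proof
  have top: "Max (block i) \<in> block i" if "alive i" for i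
    by (rule Max_in) (use that finite_block in \<open>auto simp: block_def\<close>)
  show "block_map top_of"
    unfolding block_map_def
  proof (intro allI impI)
    fix i j assume "top_of i = Some j"
    then have i: "alive i" and j: "j = Max (block i)"
      by (auto simp: top_of_def split: if_splits)
    have "block j = block i" "alive j"
      using top[OF i] i by (simp_all add: j block_eq)
    moreover have "i \<le> j"
      unfolding j by (rule Max_ge) (use finite_block[OF i] in \<open>auto simp: block_def\<close>)
    ultimately show "i \<le> j \<and> top_of j = Some j" by (simp add: top_of_def j)
  qed
  show "A = block_algebra top_of"
  proof
    show "A \<subseteq> block_algebra top_of"
    proof
      fix f assume f: "f \<in> A"
      have "spread top_of f i = f i" for i
        using f top[of i] by (auto simp: spread_def top_of_def alive_def block_def)
      then show "f \<in> block_algebra top_of"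
        using f A_subset by (auto simp: block_algebra_def s_space_eq)
    qed
    show "block_algebra top_of \<subseteq> A"
    proof
      fix f assume "f \<in> block_algebra top_of"
      then have f: "f \<in> lambda_space Suc" and eq: "f i = spread top_of f i" for i
        by (auto simp: block_algebra_def s_space_eq fun_eq_iff)
      show "f \<in> A"
      proof (rule blockwise_constant_in_A[OF f])
        fix i j assume "alive i" "j \<in> block i"
        then have "top_of j = top_of i" by (simp add: top_of_def block_eq)
        then show "f j = f i" using eq[of i] eq[of j] by (simp add: spread_def)
      next
        fix i assume "\<not> alive i"
        then show "f i = 0" using eq[of i] by (simp add: spread_def top_of_def)
      qed
    qed
  qed
qed

end


section \<open>Classification and complementation\<close>

theorem corollary4p4:
  shows "(\<forall>A. closed_star_subalgebra s_topology A \<and> infinite_dimensional A \<longrightarrow>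
            (\<exists>n :: nat \<Rightarrow> nat. strict_mono n \<and> (\<forall>k. n k \<ge> 1) \<and>
               frechet_star_isomorphic (subtopology s_topology A) (lambda_topology n))) \<and>
         (\<forall>n :: nat \<Rightarrow> nat. strict_mono n \<and> (\<forall>k. n k \<ge> 1) \<longrightarrow>
            (\<exists>A. closed_star_subalgebra s_topology A \<and> infinite_dimensional A \<and>
               frechet_star_isomorphic (lambda_topology n) (subtopology s_topology A))) \<and>
         (\<forall>A. closed_star_subalgebra s_topology A \<longrightarrow> complemented_subspace s_topology A)"
proof (intro conjI allI impI)
  fix A assume A: "closed_star_subalgebra s_topology A \<and> infinite_dimensional A"
  then obtain \<rho> where \<rho>: "block_map \<rho>" and eq: "A = block_algebra \<rho>"
    using closed_star_subalgebra_is_block_algebra by blast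
  have inf: "infinite (block_tops \<rho>)"
    using A infinite_dimensional_block_algebra[OF \<rho>] by (simp add: eq)
  let ?m = "enumerate (block_tops \<rho>)"
  have m: "strict_mono ?m" using inf by (rule strict_mono_enumerate)
  have "frechet_star_isomorphic (subtopology s_topology A) (lambda_topology (\<lambda>k. Suc (?m k)))"
    unfolding eq
    by (rule block_algebra_isomorphic_lambda(1)[OF \<rho> strict_mono_imp_inj_on[OF m] range_enumerate[OF inf]])
       simp
  with m show "\<exists>n. strict_mono n \<and> (\<forall>k. n k \<ge> 1) \<and>
      frechet_star_isomorphic (subtopology s_topology A) (lambda_topology n)"
    by (intro exI[of _ "\<lambda>k. Suc (?m k)"]) (simp add: strict_mono_def)
next
  fix n :: "nat \<Rightarrow> nat" assume n: "strict_mono n \<and> (\<forall>k. n k \<ge> 1)"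
  \<comment> \<open>Singleton blocks at the positions whose weights are the \<open>n k\<close>, and zero elsewhere.\<close>
  define m where "m k = n k - 1" for k
  define \<rho> where "\<rho> i = (if i \<in> range m then Some i else None)" for i
  have nm: "n k = Suc (m k)" for k
    using n[THEN conjunct2, rule_format, of k] by (simp add: m_def)
  have inj: "inj m"
    using n nm by (metis injI strict_mono_eq)
  have \<rho>: "block_map \<rho>" and tops: "range m = block_tops \<rho>"
    by (auto simp: block_map_def block_tops_def \<rho>_def split: if_splits)
  have "infinite_dimensional (block_algebra \<rho>)"
    using inj tops infinite_dimensional_block_algebra[OF \<rho>] by (metis finite_imageD infinite_UNIV_nat)
  then show "\<exists>A. closed_star_subalgebra s_topology A \<and> infinite_dimensional A \<and>
      frechet_star_isomorphic (lambda_topology n) (subtopology s_topology A)"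
    using closed_star_subalgebra_block_algebra block_algebra_isomorphic_lambda(2)[OF \<rho> inj tops nm]
    by blast
next
  fix A assume "closed_star_subalgebra s_topology A"
  then show "complemented_subspace s_topology A"
    using closed_star_subalgebra_is_block_algebra complemented_block_algebra by metis
qed

end
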